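(* Let $D=(\mathcal P,\mathcal B)$ be a symmetric incidence structure of type $(v,k,\lambda)$ with $v\le\frac95\cdot\frac{k^2}{\lambda}$ and $k\ge100$. Suppose $(X,Y)$ is an equinumerous incidence-free pair with $|X|\le\frac{k^2}{10\lambda}$ such that every point not in $X$ lies in at least $\frac{2|X|}{k}$ blocks not in $Y$, and every block not in $Y$ contains at least $\frac{2|X|}{k}$ points not in $X$. Then $\gamma_e(D)\le v-|X|$.
   Context: An incidence structure $D=(\mathcal P,\mathcal B)$ ($\mathcal B$ a collection of subsets, called blocks, of $\mathcal P$) is a symmetric incidence structure of type $(v,k,\lambda)$ if $|\mathcal P|=|\mathcal B|=v$, every block contains $k$ points, every point lies in $k$ blocks, $\lambda\ge1$ is the maximum number of blocks containing two distinct points, and also the maximum number of points contained in two distinct blocks. A pair $(X,Y)$, $X\subseteq\mathcal P$, $Y\subseteq\mathcal B$, is incidence-free if no point of $X$ lies in a block of $Y$, and equinumerous if $|X|=|Y|$. The incidence graph $I(D)$ is the bipartite graph on $\mathcal P\cup\mathcal B$ with $P\sim B$ iff $P\in B$; $\gamma_e(D)$ is the minimum size of a set $\Gamma$ of edges of $I(D)$ such that every edge of $I(D)$ shares a vertex with some edge of $\Gamma$. *)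

theory Defs
  imports Complex_Main
begin

definition incidence_structure :: "'a set \<Rightarrow> 'a set set \<Rightarrow> bool" where
  "incidence_structure P B \<longleftrightarrow> (\<forall>b\<in>B. b \<subseteq> P)"

text \<open>The last four conjuncts say that \<open>lam\<close> is, in the sense of an attained upper bound, the
  maximum number of blocks through two distinct points and the maximum number of points on two
  distinct blocks.\<close>

definition symmetric_incidence_structure ::
    "'a set \<Rightarrow> 'a set set \<Rightarrow> nat \<Rightarrow> nat \<Rightarrow> nat \<Rightarrow> bool" where
  "symmetric_incidence_structure P B v k lam \<longleftrightarrow>
     incidence_structure P B \<and>
     finite P \<and> card P = v \<and> card B = v \<and>
     (\<forall>b\<in>B. card b = k) \<and>
     (\<forall>p\<in>P. card {b\<in>B. p \<in> b} = k) \<and>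
     1 \<le> lam \<and>
     (\<forall>p\<in>P. \<forall>q\<in>P. p \<noteq> q \<longrightarrow> card {b\<in>B. p \<in> b \<and> q \<in> b} \<le> lam) \<and>
     (\<exists>p\<in>P. \<exists>q\<in>P. p \<noteq> q \<and> card {b\<in>B. p \<in> b \<and> q \<in> b} = lam) \<and>
     (\<forall>b\<in>B. \<forall>c\<in>B. b \<noteq> c \<longrightarrow> card (b \<inter> c) \<le> lam) \<and>
     (\<exists>b\<in>B. \<exists>c\<in>B. b \<noteq> c \<and> card (b \<inter> c) = lam)"

definition incidence_free :: "'a set \<Rightarrow> 'a set set \<Rightarrow> 'a set \<Rightarrow> 'a set set \<Rightarrow> bool" where
  "incidence_free P B X Y \<longleftrightarrow> X \<subseteq> P \<and> Y \<subseteq> B \<and> (\<forall>p\<in>X. \<forall>b\<in>Y. p \<notin> b)"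

definition equinumerous :: "'a set \<Rightarrow> 'a set set \<Rightarrow> bool" where
  "equinumerous X Y \<longleftrightarrow> card X = card Y"

text \<open>A simple graph is a pair of a vertex set and a set of edges, an edge being the two-element
  set of its ends.\<close>

definition incidence_graph ::
    "'a set \<Rightarrow> 'a set set \<Rightarrow> ('a + 'a set) set \<times> ('a + 'a set) set set" where
  "incidence_graph P B = (P <+> B, {{Inl p, Inr b} | p b. p \<in> P \<and> b \<in> B \<and> p \<in> b})"

definition edge_dominating :: "'v set \<times> 'v set set \<Rightarrow> 'v set set \<Rightarrow> bool" where
  "edge_dominating G \<Gamma> \<longleftrightarrow> \<Gamma> \<subseteq> snd G \<and> (\<forall>e\<in>snd G. \<exists>f\<in>\<Gamma>. e \<inter> f \<noteq> {})"

definition edge_domination_number :: "'v set \<times> 'v set set \<Rightarrow> nat" where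
  "edge_domination_number G = (LEAST n. \<exists>\<Gamma>. finite \<Gamma> \<and> edge_dominating G \<Gamma> \<and> card \<Gamma> = n)"

definition gamma_e :: "'a set \<Rightarrow> 'a set set \<Rightarrow> nat" where
  "gamma_e P B = edge_domination_number (incidence_graph P B)"

end

theory Submission
  imports Defs "HOL-Analysis.Convex"
begin

text \<open>
  The points outside \<open>X\<close> can be matched perfectly, along incidences, with the blocks outside \<open>Y\<close>.
  Such a matching has \<open>v - |X|\<close> edges and dominates every edge, because no edge joins \<open>X\<close> to \<open>Y\<close>.
  If Hall's condition failed, there would be nonempty \<open>A\<close> and \<open>C\<close> outside \<open>X\<close> and \<open>Y\<close> with no
  incidence between them and \<open>|A| + |C| > v - |X|\<close>; by duality let \<open>|A| \<le> |C|\<close>. Counting pairs of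
  points on a common block shows that \<open>A\<close> has at least \<open>k\<^sup>2|A| / (k + \<lambda>(|A| - 1))\<close>
  neighbours, which rules out all but very small values of \<open>|A|\<close>. The latter are impossible because
  every element of \<open>A\<close> has at least \<open>2|X|/k\<close> neighbours outside \<open>Y\<close>.
\<close>

section \<open>Hall's marriage theorem\<close>

text \<open>Halmos-Vaughan induction on the number of indices, split by whether some nonempty proper
  subset of \<open>I\<close> is tight, that is, has exactly as many neighbours as elements. A tight
  set is matched separately from its complement; without one, a single index can be matched
  arbitrarily.\<close>

theorem Hall_marriage:
  fixes N :: "'i \<Rightarrow> 'b set"
  assumes "finite I" "\<And>i. i \<in> I \<Longrightarrow> finite (N i)"
    and "\<And>S. S \<subseteq> I \<Longrightarrow> card S \<le> card (\<Union>(N ` S))"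
  shows "\<exists>f. inj_on f I \<and> (\<forall>i\<in>I. f i \<in> N i)"
  using assms
proof (induction "card I" arbitrary: I N rule: less_induct)
  case less
  note fin = \<open>finite I\<close> and finN = less.prems(2) and hall = less.prems(3)
  show ?case
  proof (cases "\<exists>S. S \<noteq> {} \<and> S \<subset> I \<and> card (\<Union>(N ` S)) = card S")
    case True
    then obtain S where S: "S \<noteq> {}" "S \<subset> I" "card (\<Union>(N ` S)) = card S"
      by blast
    define U where "U = \<Union>(N ` S)"
    have subS: "S \<subseteq> I"
      using S(2) by blast
    then have finS: "finite S"
      using fin by (rule finite_subset)
    have "card S < card I"
      using S fin by (simp add: psubset_card_mono)
    then have "\<exists>f. inj_on f S \<and> (\<forall>i\<in>S. f i \<in> N i)"
    proof (rule less.hyps[OF _ finS])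
      show "finite (N i)" if "i \<in> S" for i
        using that subS finN by blast
      show "card T \<le> card (\<Union>(N ` T))" if "T \<subseteq> S" for T
        using that subS hall by blast
    qed
    then obtain f where f: "inj_on f S" "\<forall>i\<in>S. f i \<in> N i"
      by blast
    \<comment> \<open>The rest may use only values outside \<open>U\<close>. Hall's condition
      survives there: apply it to \<open>T \<union> S\<close> and subtract the tight equality for
      \<open>S\<close>.\<close>
    have hall': "card T \<le> card (\<Union>i\<in>T. N i - U)" if T: "T \<subseteq> I - S" for T
    proof -
      have finT: "finite T"
        using T fin by (rule finite_subset[OF _ finite_Diff])
      have "card T + card S = card (T \<union> S)"
        using T finT finS by (subst card_Un_disjoint) auto
      also have "\<dots> \<le> card (\<Union>(N ` (T \<union> S)))"
        using T subS by (intro hall) blast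
      also have "\<Union>(N ` (T \<union> S)) = (\<Union>i\<in>T. N i - U) \<union> U"
        by (auto simp: U_def)
      also have "card \<dots> \<le> card (\<Union>i\<in>T. N i - U) + card U"
        by (rule card_Un_le)
      finally show ?thesis
        using S(3) by (simp add: U_def)
    qed
    have "card (I - S) < card I"
      using S fin by (intro psubset_card_mono) auto
    then have "\<exists>g. inj_on g (I - S) \<and> (\<forall>i\<in>I - S. g i \<in> N i - U)"
      using fin finN by (intro less.hyps hall') auto
    then obtain g where g: "inj_on g (I - S)" "\<forall>i\<in>I - S. g i \<in> N i - U"
      by blast
    have "f i \<noteq> g j" if "i \<in> S" "j \<in> I - S" for i j
      using that f(2) g(2) by (auto simp: U_def)
    then have "inj_on (\<lambda>i. if i \<in> S then f i else g i) (S \<union> (I - S))"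
      using f(1) g(1) by (subst inj_on_Un) (auto simp: inj_on_def)
    then have "inj_on (\<lambda>i. if i \<in> S then f i else g i) I"
      using subS by (simp add: Un_absorb1)
    moreover have "\<forall>i\<in>I. (if i \<in> S then f i else g i) \<in> N i"
      using f g by auto
    ultimately show ?thesis
      by blast
  next
    case False
    show ?thesis
    proof (cases "I = {}")
      case True
      then show ?thesis by simp
    next
      case nonempty: False
      then obtain i where i: "i \<in> I" by blast
      have "card {i} \<le> card (\<Union>(N ` {i}))"
        using i by (intro hall) auto
      then have "N i \<noteq> {}"
        by auto
      then obtain y where y: "y \<in> N i" by blast
      \<comment> \<open>With no tight subset, every nonempty \<open>T\<close> missing
        \<open>i\<close> has at least one neighbour to spare, so deleting \<open>y\<close> does no
        harm.\<close>
      have hall': "card T \<le> card (\<Union>j\<in>T. N j - {y})" if T: "T \<subseteq> I - {i}" for T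
      proof (cases "T = {}")
        case True
        then show ?thesis by simp
      next
        case ne: False
        have "T \<subset> I" using T i by blast
        with ne False have "card (\<Union>(N ` T)) \<noteq> card T"
          by blast
        moreover have "card T \<le> card (\<Union>(N ` T))"
          using \<open>T \<subset> I\<close> by (intro hall) auto
        moreover have "card (\<Union>(N ` T)) - card {y} \<le> card (\<Union>(N ` T) - {y})"
          by (rule diff_card_le_card_Diff) simp
        then have "card (\<Union>(N ` T)) \<le> card (\<Union>(N ` T) - {y}) + 1"
          by simp
        ultimately have "card T \<le> card (\<Union>(N ` T) - {y})"
          by linarith
        also have "\<Union>(N ` T) - {y} = (\<Union>j\<in>T. N j - {y})"
          by auto
        finally show ?thesis .
      qed
      have "card (I - {i}) < card I"
        using i fin by (intro psubset_card_mono) auto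
      then have "\<exists>g. inj_on g (I - {i}) \<and> (\<forall>j\<in>I - {i}. g j \<in> N j - {y})"
        using fin finN by (intro less.hyps hall') auto
      then obtain g where g: "inj_on g (I - {i})" "\<forall>j\<in>I - {i}. g j \<in> N j - {y}"
        by blast
      then have "inj_on (g(i := y)) (insert i (I - {i}))"
        by (subst inj_on_insert) (auto simp: inj_on_def)
      then have "inj_on (g(i := y)) I"
        using i by (simp add: insert_absorb)
      moreover have "\<forall>j\<in>I. (g(i := y)) j \<in> N j"
        using g y by auto
      ultimately show ?thesis
        by blast
    qed
  qed
qed

section \<open>Expansion and the failure of Hall's condition\<close>

text \<open>Double counting with Cauchy-Schwarz: if \<open>d b\<close> elements of \<open>S\<close>
  are related to \<open>b\<close>, then the \<open>d b\<close> sum to \<open>k * card S\<close>,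
  while their squares count ordered pairs in \<open>S\<close> with a common neighbour, a diagonal
  pair contributing \<open>k\<close> and any other at most \<open>lam\<close>. Degrees are taken
  inside \<open>N\<close>, so \<open>N\<close> has to contain whole neighbourhoods.\<close>

lemma neighbourhood_lower_bound:
  fixes R :: "'a \<Rightarrow> 'b \<Rightarrow> bool" and k lam :: nat
  assumes "finite S" "finite N" "S \<noteq> {}"
    and deg: "\<And>p. p \<in> S \<Longrightarrow> card {b\<in>N. R p b} = k"
    and codeg: "\<And>p q. p \<in> S \<Longrightarrow> q \<in> S \<Longrightarrow> p \<noteq> q \<Longrightarrow> card {b\<in>N. R p b \<and> R q b} \<le> lam"
  shows "(real k)\<^sup>2 * card S \<le> card N * (real k + real lam * (real (card S) - 1))"
proof -
  define d where "d b = (\<Sum>p\<in>S. of_bool (R p b) :: real)" for b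
  have card_eq: "(\<Sum>b\<in>N. of_bool (Q b) :: real) = real (card {b\<in>N. Q b})" for Q
    using \<open>finite N\<close> by (simp add: Int_def)
  have sum_d: "sum d N = real k * card S"
    unfolding d_def by (subst sum.swap) (simp add: card_eq deg del: sum_of_bool_eq)
  have "(\<Sum>b\<in>N. (d b)\<^sup>2) = (\<Sum>b\<in>N. \<Sum>p\<in>S. \<Sum>q\<in>S. of_bool (R p b \<and> R q b))"
    unfolding d_def power2_eq_square sum_product by (simp add: of_bool_conj)
  also have "\<dots> = (\<Sum>p\<in>S. \<Sum>b\<in>N. \<Sum>q\<in>S. of_bool (R p b \<and> R q b))"
    by (rule sum.swap)
  also have "\<dots> = (\<Sum>p\<in>S. \<Sum>q\<in>S. \<Sum>b\<in>N. of_bool (R p b \<and> R q b))"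
    by (intro sum.cong refl sum.swap)
  also have "\<dots> = (\<Sum>p\<in>S. \<Sum>q\<in>S. real (card {b\<in>N. R p b \<and> R q b}))"
    by (simp only: card_eq)
  also have "\<dots> \<le> (\<Sum>p\<in>S. real k + real lam * (real (card S) - 1))"
  proof (rule sum_mono)
    fix p assume p: "p \<in> S"
    have "(\<Sum>q\<in>S. real (card {b\<in>N. R p b \<and> R q b}))
        = real k + (\<Sum>q\<in>S - {p}. real (card {b\<in>N. R p b \<and> R q b}))"
      using p \<open>finite S\<close> by (simp add: sum.remove[of S p] deg)
    also have "\<dots> \<le> real k + (\<Sum>q\<in>S - {p}. real lam)"
      using p codeg by (intro add_left_mono sum_mono) auto
    also have "\<dots> = real k + real lam * (real (card S) - 1)"
    proof -
      have "card S \<ge> 1"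
        using assms(1,3) by (simp add: Suc_le_eq card_gt_0_iff)
      then show ?thesis
        using p \<open>finite S\<close> by (simp add: of_nat_diff)
    qed
    finally show "(\<Sum>q\<in>S. real (card {b\<in>N. R p b \<and> R q b}))
        \<le> real k + real lam * (real (card S) - 1)" .
  qed
  finally have sum_d2: "(\<Sum>b\<in>N. (d b)\<^sup>2) \<le> card S * (real k + real lam * (real (card S) - 1))"
    by simp
  have "(real k * card S)\<^sup>2 \<le> (\<Sum>b\<in>N. (d b)\<^sup>2) * card N"
    using sum_squared_le_sum_of_squares[of d N] \<open>finite N\<close> sum_d by (cases "N = {}") auto
  also have "\<dots> \<le> card S * (real k + real lam * (real (card S) - 1)) * card N"
    using sum_d2 by (rule mult_right_mono) simp
  finally have "card S * ((real k)\<^sup>2 * card S)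
      \<le> card S * (card N * (real k + real lam * (real (card S) - 1)))"
    by (simp add: power2_eq_square mult_ac)
  moreover have "real (card S) > 0"
    using assms by (simp add: card_gt_0_iff)
  ultimately show ?thesis
    by (simp only: mult_le_cancel_left_pos)
qed

text \<open>The numerical core. Here \<open>a\<close> and \<open>b\<close> are the sizes of the two
  sides of a non-incident pair, \<open>n\<close> is the size of the neighbourhood of the smaller
  side, and \<open>x\<close> is the common size of \<open>X\<close> and \<open>Y\<close>. In units
  of \<open>K = k\<^sup>2 / l\<close> everything becomes linear: \<open>v\<close> is at most 9/5,
  \<open>x\<close> at most 1/10, and \<open>e = k / l\<close> at most 1/100 because
  \<open>k \<ge> 100\<close>.\<close>

lemma expansion_contradiction:
  fixes a b x v k l n :: real
  assumes "k \<ge> 100" "l > 0" "a > 0" "a \<le> b" "x \<ge> 0" "v < a + b + x"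
    and "n \<le> v - b" "n \<ge> 0" "k\<^sup>2 * a \<le> n * (k + l * (a - 1))"
    and "v \<le> 9 / 5 * (k\<^sup>2 / l)" "x \<le> k\<^sup>2 / (10 * l)" "2 * x / k \<le> a"
  shows False
proof -
  define K where "K = k\<^sup>2 / l"
  define e where "e = k / l"
  have K: "K > 0" and e: "e > 0" "e \<le> K / 100" and Ke: "K = k * e"
    using assms by (auto simp: K_def e_def field_simps power2_eq_square)
  have x: "x \<le> K / 10" and v: "v \<le> 9/5 * K"
    using assms by (auto simp: K_def)
  have "K * a \<le> n * (e + a - 1)"
    using assms(2,9) by (simp add: K_def e_def field_simps)
  also have "\<dots> \<le> n * (e + a)"
    using assms by (intro mult_left_mono) auto
  finally have n: "K * a \<le> n * (e + a)" .
  show False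
  proof (cases "a \<ge> 17/20 * K")
    case True
    \<comment> \<open>Since \<open>b \<ge> a\<close>, the neighbourhood has at most (9/5 - 17/20)
      \<open>K\<close> elements. Expansion then forces \<open>a \<le> 19 * e\<close>, which is at
      most 19/100 of \<open>K\<close>.\<close>
    have "n \<le> 19/20 * K"
      using True assms(4,7) v by linarith
    then have "n * (e + a) \<le> 19/20 * K * (e + a)"
      using e assms by (intro mult_right_mono) auto
    with n have "K * a \<le> K * (19/20 * (e + a))"
      by (simp only: mult_ac)
    then have "a \<le> 19/20 * (e + a)"
      using K by (simp only: mult_le_cancel_left_pos)
    then have "a \<le> 19 * e"
      by (simp add: field_simps)
    with True e K show False
      by linarith
  next
    case False
    \<comment> \<open>From \<open>n \<le> v - b\<close> and \<open>v < a + b + x\<close> it follows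
      that \<open>n < a + x\<close>.\<close>
    have "n * (e + a) \<le> (a + x) * (e + a)"
      using assms e by (intro mult_right_mono) auto
    with n have *: "K * a \<le> (a + x + e) * a + x * e"
      by (simp add: algebra_simps)
    \<comment> \<open>For \<open>a\<close> up to 3/10 of \<open>K\<close>, the bracket exceeds
      \<open>K / 2\<close> and the degree condition \<open>2 * x / k \<le> a\<close> gives
      \<open>x * e \<le> K / 2 * a\<close>. For larger \<open>a\<close>, the bracket is still at
      least \<open>K / 100\<close>, and the crude bound of \<open>K\<^sup>2\<close> / 1000 on
      \<open>x * e\<close> suffices.\<close>
    have "x * e < (K - (a + x + e)) * a"
    proof (cases "a \<le> 3/10 * K")
      case True
      have "2 * x \<le> a * k"
        using assms by (simp add: field_simps)
      then have "2 * x * e \<le> a * k * e"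
        using e by (intro mult_right_mono) auto
      then have "x * e \<le> K / 2 * a"
        by (simp add: Ke mult_ac)
      also have "\<dots> < (K - (a + x + e)) * a"
        using True x e K assms by (intro mult_strict_right_mono) auto
      finally show ?thesis .
    next
      case large: False
      have "x * e \<le> (K / 10) * (K / 100)"
        using x e K assms by (intro mult_mono) auto
      also have "\<dots> < K / 100 * a"
        using large K by (simp add: field_simps)
      also have "\<dots> \<le> (K - (a + x + e)) * a"
        using False x e K assms by (intro mult_right_mono) auto
      finally show ?thesis .
    qed
    with * show False
      by (simp add: algebra_simps)
  qed
qed

text \<open>The relation \<open>R\<close> is abstract so that the lemma serves both for points
  against blocks and for the dual. It reduces to \<open>expansion_contradiction\<close>, with
  \<open>N\<close> the full neighbourhood of \<open>A\<close>, which is disjoint from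
  \<open>C\<close>.\<close>

lemma no_large_incidence_free_pair:
  fixes R :: "'a \<Rightarrow> 'b \<Rightarrow> bool" and v k lam :: nat
  assumes "finite B" "card B = v"
    and deg: "\<And>p. p \<in> A \<Longrightarrow> card {b\<in>B. R p b} = k"
    and codeg: "\<And>p q. p \<in> A \<Longrightarrow> q \<in> A \<Longrightarrow> p \<noteq> q \<Longrightarrow> card {b\<in>B. R p b \<and> R q b} \<le> lam"
    and "lam \<ge> 1" "k \<ge> 100" "real v \<le> 9 / 5 * ((real k)\<^sup>2 / lam)"
    and "Y \<subseteq> B" "card Y = x" "real x \<le> (real k)\<^sup>2 / (10 * real lam)"
    and mindeg: "\<And>p. p \<in> A \<Longrightarrow> 2 * real x / k \<le> card {b\<in>B - Y. R p b}"
    and A: "finite A" "A \<noteq> {}" and C: "C \<subseteq> B - Y"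
    and free: "\<And>p b. p \<in> A \<Longrightarrow> b \<in> C \<Longrightarrow> \<not> R p b"
    and "card A \<le> card C" "v < card A + card C + x"
  shows False
proof -
  define N where "N = {b\<in>B. \<exists>p\<in>A. R p b}"
  have fin: "finite N" "finite Y" "finite C"
    using assms(1) \<open>Y \<subseteq> B\<close> C by (auto simp: N_def intro: finite_subset)
  have "card (N \<union> C) \<le> card B"
    using C \<open>finite B\<close> by (intro card_mono) (auto simp: N_def)
  moreover have "card (N \<union> C) = card N + card C"
    using free fin by (intro card_Un_disjoint) (auto simp: N_def)
  ultimately have N_le: "card N + card C \<le> v"
    using assms(2) by simp
  have N_eq: "{b\<in>N. R p b} = {b\<in>B. R p b}"
    "{b\<in>N. R p b \<and> R q b} = {b\<in>B. R p b \<and> R q b}" if "p \<in> A" for p q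
    using that by (auto simp: N_def)
  have bound: "(real k)\<^sup>2 * card A \<le> card N * (real k + real lam * (real (card A) - 1))"
    using A fin deg codeg by (intro neighbourhood_lower_bound[where R = R]) (simp_all add: N_eq)
  obtain p where p: "p \<in> A"
    using A by blast
  let ?D = "{b\<in>B - Y. R p b}"
  \<comment> \<open>The neighbours of one \<open>p\<close> outside \<open>Y\<close>, the set
    \<open>C\<close> and \<open>Y\<close> are pairwise disjoint in \<open>B\<close>. As
    \<open>A\<close>, \<open>C\<close> and \<open>Y\<close> together exceed \<open>v\<close> in
    size, \<open>A\<close> must be at least as large as \<open>?D\<close>.\<close>
  have "card (?D \<union> C \<union> Y) \<le> card B"
    using C \<open>Y \<subseteq> B\<close> \<open>finite B\<close> by (intro card_mono) auto
  moreover have "card (?D \<union> C \<union> Y) = card ?D + card C + card Y"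
    using free[OF p] fin C \<open>finite B\<close> by (subst card_Un_disjoint; auto)+
  ultimately have "card ?D \<le> card A"
    using assms by linarith
  then have small: "2 * real x / k \<le> card A"
    using mindeg[OF p] by linarith
  have "real v < real (card A) + real (card C) + real x"
    using assms(17) by (simp flip: of_nat_add)
  moreover have "real (card N) \<le> real v - card C"
    using N_le by linarith
  moreover have "real (card A) > 0"
    using A by (simp add: card_gt_0_iff)
  ultimately show False
    using assms bound small
    by (intro expansion_contradiction[of "real k" "real lam" "real (card A)" "real (card C)"
          "real x" "real v" "real (card N)"]) auto
qed

section \<open>The matching and edge domination\<close>

lemma edge_domination_number_le:
  assumes "finite \<Gamma>" "edge_dominating G \<Gamma>"
  shows "edge_domination_number G \<le> card \<Gamma>"
  unfolding edge_domination_number_def using assms by (intro Least_le) auto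

theorem theorem5p8:
  fixes P :: "'a set" and B :: "'a set set"
    and X :: "'a set" and Y :: "'a set set"
    and v k lam :: nat
  assumes "symmetric_incidence_structure P B v k lam"
    and "real v \<le> 9 / 5 * ((real k)^2 / real lam)"
    and "k \<ge> 100"
    and "incidence_free P B X Y"
    and "equinumerous X Y"
    and "real (card X) \<le> (real k)^2 / (10 * real lam)"
    and "\<forall>p\<in>P - X. real (card {b \<in> B - Y. p \<in> b}) \<ge> 2 * real (card X) / real k"
    and "\<forall>b\<in>B - Y. real (card {p \<in> P - X. p \<in> b}) \<ge> 2 * real (card X) / real k"
  shows "real (gamma_e P B) \<le> real v - real (card X)"
proof -
  have sub: "\<And>b. b \<in> B \<Longrightarrow> b \<subseteq> P" and finP: "finite P" and cards: "card P = v" "card B = v"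
    and block_deg: "\<And>b. b \<in> B \<Longrightarrow> card b = k"
    and point_deg: "\<And>p. p \<in> P \<Longrightarrow> card {b\<in>B. p \<in> b} = k"
    and lam: "1 \<le> lam"
    and point_codeg:
      "\<And>p q. p \<in> P \<Longrightarrow> q \<in> P \<Longrightarrow> p \<noteq> q \<Longrightarrow> card {b\<in>B. p \<in> b \<and> q \<in> b} \<le> lam"
    and block_codeg: "\<And>b c. b \<in> B \<Longrightarrow> c \<in> B \<Longrightarrow> b \<noteq> c \<Longrightarrow> card (b \<inter> c) \<le> lam"
    using assms(1) unfolding symmetric_incidence_structure_def incidence_structure_def by simp_all
  have XY: "X \<subseteq> P" "Y \<subseteq> B" "\<And>p b. p \<in> X \<Longrightarrow> b \<in> Y \<Longrightarrow> p \<notin> b" and cardXY: "card Y = card X"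
    using assms(4,5) unfolding incidence_free_def equinumerous_def by auto
  have finB: "finite B"
    using sub finP by (intro finite_subset[of B "Pow P"]) auto
  have fin: "finite X" "finite Y"
    using XY finP finB by (auto intro: finite_subset)
  have card_diff: "card (P - X) = v - card X" "card (B - Y) = v - card X" "card X \<le> v"
    using XY fin cards cardXY finP by (auto simp: card_Diff_subset intro: card_mono)
  have block_deg': "{p\<in>P. p \<in> b} = b" "{p\<in>P. p \<in> b \<and> p \<in> c} = b \<inter> c" if "b \<in> B" for b c
    using sub[OF that] by auto
  have hall: "card S \<le> card (\<Union>p\<in>S. {b\<in>B - Y. p \<in> b})" if S: "S \<subseteq> P - X" for S
  proof (rule ccontr)
    define M where "M = (\<Union>p\<in>S. {b\<in>B - Y. p \<in> b})"
    \<comment> \<open>\<open>C\<close> consists of the blocks outside \<open>Y\<close> that miss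
      \<open>S\<close>; a deficient \<open>S\<close> makes \<open>S\<close> and \<open>C\<close>
      together larger than \<open>v - card X\<close>.\<close>
    define C where "C = (B - Y) - M"
    assume "\<not> ?thesis"
    then have less: "card M < card S"
      by (simp add: M_def)
    have finS: "finite S"
      using S finP by (meson finite_Diff finite_subset)
    have M: "M \<subseteq> B - Y" "finite M"
      using finB by (auto simp: M_def intro: finite_subset[of _ B])
    have cardC: "card C = v - card X - card M"
      using M card_diff by (simp add: C_def card_Diff_subset)
    have "card S \<le> v - card X"
      using S finP card_diff card_mono[of "P - X" S] by simp
    with cardC less have pos: "card C > 0" "v < card S + card C + card X"
      by linarith+
    have C: "C \<noteq> {}" "finite C" "C \<subseteq> B - Y"
      using pos(1) by (simp_all only: card_gt_0_iff) (simp_all add: C_def)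
    have "S \<noteq> {}"
      using less by auto
    have free: "p \<notin> b" if "p \<in> S" "b \<in> C" for p b
      using that by (auto simp: C_def M_def)
    show False
    \<comment> \<open>The smaller of \<open>S\<close> and \<open>C\<close> takes the role of
      \<open>A\<close>. If it is \<open>C\<close>, points and blocks are exchanged, and
      \<open>X\<close> takes the place of \<open>Y\<close>.\<close>
    proof (cases "card S \<le> card C")
      case True
      show False
      proof (rule no_large_incidence_free_pair[where R = "\<lambda>p b. p \<in> b" and A = S and B = B])
        show "card {b\<in>B. p \<in> b} = k" "2 * real (card X) / k \<le> card {b\<in>B - Y. p \<in> b}"
          if "p \<in> S" for p
          using that S point_deg assms(7) by blast+
        show "card {b\<in>B. p \<in> b \<and> q \<in> b} \<le> lam" if "p \<in> S" "q \<in> S" "p \<noteq> q" for p q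
          using that S point_codeg by blast
      qed (fact finB cards lam assms XY cardXY finS \<open>S \<noteq> {}\<close> C free True pos | assumption)+
    next
      case False
      show False
      proof (rule no_large_incidence_free_pair[where R = "\<lambda>b p. p \<in> b" and A = C and B = P])
        show "card {p\<in>P. p \<in> b} = k" "2 * real (card X) / k \<le> card {p\<in>P - X. p \<in> b}"
          if "b \<in> C" for b
          using that C block_deg block_deg' assms(8) by auto
        show "card {p\<in>P. p \<in> b \<and> p \<in> c} \<le> lam" if "b \<in> C" "c \<in> C" "b \<noteq> c" for b c
        proof -
          have "b \<in> B" "c \<in> B"
            using that C by auto
          then show ?thesis
            using block_codeg[of b c] that by (simp add: block_deg')
        qed
        show "\<not> p \<in> b" if "b \<in> C" "p \<in> S" for b p
          using that free by blast
        show "card C \<le> card S" "v < card C + card S + card X"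
          using False pos by linarith+
      qed (fact finP cards lam assms XY refl C S)+
    qed
  qed
  obtain f where f: "inj_on f (P - X)" "\<And>p. p \<in> P - X \<Longrightarrow> f p \<in> B - Y \<and> p \<in> f p"
    using Hall_marriage[of "P - X" "\<lambda>p. {b\<in>B - Y. p \<in> b}"] finP finB hall by auto
  \<comment> \<open>Equinumerosity makes the injective matching onto, so that it also covers every
    block outside \<open>Y\<close>.\<close>
  have "f ` (P - X) = B - Y"
    using f finB card_diff by (intro card_subset_eq) (auto simp: card_image)
  define \<Gamma> where "\<Gamma> = (\<lambda>p. {Inl p, Inr (f p)}) ` (P - X)"
  have "edge_dominating (incidence_graph P B) \<Gamma>"
    unfolding edge_dominating_def
  proof (intro conjI ballI)
    show "\<Gamma> \<subseteq> snd (incidence_graph P B)"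
      using f(2) by (fastforce simp: \<Gamma>_def incidence_graph_def)
  next
    fix e assume "e \<in> snd (incidence_graph P B)"
    then obtain p b where e: "e = {Inl p, Inr b}" "p \<in> P" "b \<in> B" "p \<in> b"
      by (auto simp: incidence_graph_def)
    \<comment> \<open>This is where incidence-freeness enters: an edge cannot join \<open>X\<close>
      to \<open>Y\<close>, so one of its ends is covered by the matching.\<close>
    then consider "p \<in> P - X" | "b \<in> B - Y"
      using XY(3) by blast
    then show "\<exists>g\<in>\<Gamma>. e \<inter> g \<noteq> {}"
    proof cases
      case 1
      then show ?thesis
        using e by (auto simp: \<Gamma>_def)
    next
      case 2
      then obtain q where "q \<in> P - X" "b = f q"
        using \<open>f ` (P - X) = B - Y\<close> by blast
      then show ?thesis
        using e by (auto simp: \<Gamma>_def)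
    qed
  qed
  then have "gamma_e P B \<le> card \<Gamma>"
    unfolding gamma_e_def using finP by (intro edge_domination_number_le) (auto simp: \<Gamma>_def)
  also have "\<dots> \<le> v - card X"
    using card_image_le[of "P - X" "\<lambda>p. {Inl p, Inr (f p)}"] finP card_diff by (simp add: \<Gamma>_def)
  finally show ?thesis
    using card_diff(3) by linarith
qed

end
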